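(* For all integers $n\ge k\ge 1$, the varied Ward numbers of the first kind $A^*(n,k)$ satisfy $$A^*(n,k)=\frac{2n(2n-1)}{n+k}\Big((n+k-1)\,A^*(n-1,k)+k\,A^*(n-1,k-1)\Big),$$ with $A^*(0,0)=1$, $A^*(n,0)=0$ for $n\ge1$, $A^*(0,k)=0$ for $k\ge1$, and $A^*(n,k)=0$ for $k>n$.
   Context: Ward numbers of the first kind $A(n,k)$: defined for $n\ge k\ge 1$ by the recurrence $A(n,k)=(n+k-1)\big(A(n-1,k)+A(n-1,k-1)\big)$, with $A(0,0)=1$, $A(n,0)=0$ for $n\ge 1$, $A(0,k)=0$ for $k\ge 1$, and $A(n,k)=0$ for $k>n$. Falling factorial: $x^{\underline{n}}=\prod_{i=0}^{n-1}(x-i)$, so $(n+k)^{\underline{n}}=\frac{(n+k)!}{k!}$. Varied Ward numbers of the first kind: for integers $n,k\ge 0$, $A^*(n,k)=\dfrac{(2n)!}{(n+k)^{\underline{n}}}\,A(n,k)$. *)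

theory Defs
  imports Complex_Main
begin

(* The third equation is the recurrence at (n + 1, k + 1), where its factor
   (n + 1) + (k + 1) - 1 is n + k + 1; it applies when n + 1 >= k + 1, and the
   convention that the numbers vanish above the diagonal covers the other case. *)
fun ward1 :: "nat \<Rightarrow> nat \<Rightarrow> nat" where
  "ward1 0 k = (if k = 0 then 1 else 0)"
| "ward1 (Suc n) 0 = 0"
| "ward1 (Suc n) (Suc k) =
     (if k \<le> n then (n + k + 1) * (ward1 n (Suc k) + ward1 n k) else 0)"

definition falling_factorial :: "'a::comm_ring_1 \<Rightarrow> nat \<Rightarrow> 'a" where
  "falling_factorial x n = (\<Prod>i<n. x - of_nat i)"

(* Rational-valued, so that the quotient is exact; the denominator is never 0. *)
definition varied_ward1 :: "nat \<Rightarrow> nat \<Rightarrow> rat" where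
  "varied_ward1 n k =
     fact (2 * n) / falling_factorial (of_nat (n + k)) n * of_nat (ward1 n k)"

end

theory Submission
  imports Defs
begin

text \<open>The falling factorial is (n+k)!/k!, so A*(n,k) = (2n)! k!/(n+k)! A(n,k)
  (\<open>varied_ward1_conv_fact\<close>). Insert the Ward recurrence: its factor n+k-1 cancels
  against (n+k)! = (n+k)(n+k-1)(n+k-2)!, and (2n)! releases 2n(2n-1). What multiplies A(n-1,k) is
  then (n+k-1) times its own normalisation, and what multiplies A(n-1,k-1) is k times its
  own.\<close>

lemma falling_factorial_mult_fact:
  "falling_factorial (of_nat (n + k)) n * fact k = (fact (n + k) :: 'a :: {comm_ring_1, ring_char_0})"
proof (induction n)
  case 0
  then show ?case by (simp add: falling_factorial_def)
next
  case (Suc n)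
  \<comment> \<open>Splitting off the factor at i = 0 instead of the last one lowers the argument by
    one, as the induction hypothesis requires.\<close>
  have "falling_factorial (of_nat (Suc n + k)) (Suc n) =
      (of_nat (Suc n + k) * falling_factorial (of_nat (n + k)) n :: 'a)"
    by (simp add: falling_factorial_def prod.lessThan_Suc_shift del: prod.lessThan_Suc)
  with Suc.IH show ?case
    by (simp only: mult.assoc add_Suc fact_Suc)
qed

lemma varied_ward1_conv_fact:
  "varied_ward1 n k = fact (2 * n) * fact k / fact (n + k) * of_nat (ward1 n k)"
  by (simp add: varied_ward1_def flip: falling_factorial_mult_fact)

lemma ward1_eq_0: "n < k \<Longrightarrow> ward1 n k = 0"
  by (cases "(n, k)" rule: ward1.cases) auto

lemma varied_ward1_Suc_Suc:
  assumes "j \<le> m"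
  shows "varied_ward1 (Suc m) (Suc j) =
    (2 * of_nat (Suc m) * (2 * of_nat (Suc m) - 1)) / (of_nat (Suc m) + of_nat (Suc j)) *
    ((of_nat (Suc m) + of_nat (Suc j) - 1) * varied_ward1 m (Suc j)
      + of_nat (Suc j) * varied_ward1 m j)"
proof -
  \<comment> \<open>With n = m+1 and k = j+1, these are n+k-1 and n+k.\<close>
  define s t where "s = (of_nat m + of_nat j + 1 :: rat)" and "t = (of_nat m + of_nat j + 2 :: rat)"
  have pos: "s > 0" "t > 0"
    by (simp_all add: s_def t_def add_nonneg_pos)
  have sums: "of_nat (Suc m) + of_nat (Suc j) = t" "t - 1 = s"
    by (simp_all add: s_def t_def)
  \<comment> \<open>Here \<open>j \<le> m\<close> selects the nonzero branch.\<close>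
  have ward: "of_nat (ward1 (Suc m) (Suc j)) = s * (of_nat (ward1 m (Suc j)) + of_nat (ward1 m j))"
    using assms by (simp add: s_def algebra_simps)
  have facts: "fact (m + Suc j) = s * fact (m + j)"
    "fact (Suc m + Suc j) = t * (s * fact (m + j))"
    by (simp_all add: s_def t_def algebra_simps)
  have fact2: "(fact (2 * Suc m) :: rat) =
      2 * of_nat (Suc m) * (2 * of_nat (Suc m) - 1) * fact (2 * m)"
    by (simp add: algebra_simps)
  \<comment> \<open>The identity on opaque atoms, so that no factorial gets unfolded: P = 2n(2n-1),
    F = (2n-2)!, c = k, g = (k-1)!, h = (n+k-2)!, and a, b are the two preceding Ward
    numbers.\<close>
  have "P * F * (c * g) / (t * (s * h)) * (s * (a + b)) =
      P / t * (s * (F * (c * g) / (s * h) * a) + c * (F * g / h * b))" if "h \<noteq> 0"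
    for P F c g h a b :: rat
    using pos that by (simp add: field_simps)
  then show ?thesis
    unfolding varied_ward1_conv_fact ward facts fact2 sums fact_Suc[of j] of_nat_mult
    by (simp only: fact_nonzero not_False_eq_True)
qed

theorem theorem3p2:
  shows "(\<forall>n k :: nat. 1 \<le> k \<and> k \<le> n \<longrightarrow>
            varied_ward1 n k =
              (2 * of_nat n * (2 * of_nat n - 1)) / (of_nat n + of_nat k) *
              ((of_nat n + of_nat k - 1) * varied_ward1 (n - 1) k
               + of_nat k * varied_ward1 (n - 1) (k - 1)))
       \<and> varied_ward1 0 0 = 1
       \<and> (\<forall>n :: nat. n \<ge> 1 \<longrightarrow> varied_ward1 n 0 = 0)
       \<and> (\<forall>k :: nat. k \<ge> 1 \<longrightarrow> varied_ward1 0 k = 0)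
       \<and> (\<forall>n k :: nat. k > n \<longrightarrow> varied_ward1 n k = 0)"
proof (intro conjI allI impI)
  fix n k :: nat
  assume "1 \<le> k \<and> k \<le> n"
  then obtain m j where "n = Suc m" "k = Suc j" "j \<le> m"
    by (cases n; cases k) auto
  then show "varied_ward1 n k =
              (2 * of_nat n * (2 * of_nat n - 1)) / (of_nat n + of_nat k) *
              ((of_nat n + of_nat k - 1) * varied_ward1 (n - 1) k
               + of_nat k * varied_ward1 (n - 1) (k - 1))"
    using varied_ward1_Suc_Suc[of j m] by (simp only: diff_Suc_1)
next
  show "varied_ward1 n 0 = 0" if "n \<ge> 1" for n
    using that by (cases n) (simp_all add: varied_ward1_def)
\<comment> \<open>The other boundary values come from row 0 and from vanishing above the
  diagonal.\<close>
qed (simp_all add: varied_ward1_conv_fact ward1_eq_0)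

end
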